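(* Let $n$ and $N$ be positive even integers with $N\ge n$, and let $P\in\{P_n^{<,<},P_n^{>,>},P_n^{<,>},P_n^{>,<}\}$. Then \[ \mathrm{ex}_<(N/2,N/2,P)=\left(\frac n2-1\right)\left(N-\frac n2+1\right). \]
   Context: An ordered graph is a graph whose vertex set is equipped with a total order; ordered graphs on $[m]=\{1,\dots,m\}$ use the natural order of the integers. An ordered graph $G$ contains an ordered graph $H$ if there is an injection $f:V(H)\to V(G)$ such that $f(i)<f(j)$ whenever $i<j$, and $f(i)f(j)\in E(G)$ whenever $ij\in E(H)$; otherwise $G$ avoids $H$. For a positive integer $M$, the ordered bipartite Turán number $\mathrm{ex}_<(M,M,H)$ is the maximum number of edges of an ordered graph on vertex set $[2M]$ all of whose edges join a vertex of $[1,M]$ to a vertex of $[M+1,2M]$, and which avoids $H$. For $n=2k$ even, the ordered paths $P_n^{r_1,r_2}$ on $[n]$ are defined by their vertex sequences $v_1,\dots,v_n$ along the path, for $j=1,\dots,k$: $P_n^{<,<}$: $v_{2j-1}=j$, $v_{2j}=k+j$; $P_n^{>,>}$: $v_{2j-1}=k+1-j$, $v_{2j}=2k+1-j$; $P_n^{<,>}$: $v_{2j-1}=j$, $v_{2j}=2k+1-j$ (this is the alternating path $1,n,2,n-1,\dots$); $P_n^{>,<}$: $v_{2j-1}=k+1-j$, $v_{2j}=k+j$. *)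

theory Defs
  imports Main
begin

text \<open>A graph is given by its vertex set and its set of edges, the latter being two-element
  sets of vertices. The order of an ordered graph is the one of the vertex type.\<close>

type_synonym 'a ograph = "'a set \<times> 'a set set"

abbreviation verts :: "'a ograph \<Rightarrow> 'a set" where
  "verts G \<equiv> fst G"

abbreviation edges :: "'a ograph \<Rightarrow> 'a set set" where
  "edges G \<equiv> snd G"

definition ordered_graph :: "'a::linorder ograph \<Rightarrow> bool" where
  "ordered_graph G \<longleftrightarrow> finite (verts G) \<and> (\<forall>e\<in>edges G. e \<subseteq> verts G \<and> card e = 2)"

definition contains :: "'a::linorder ograph \<Rightarrow> 'b::linorder ograph \<Rightarrow> bool" where
  "contains G H \<longleftrightarrow>
     (\<exists>f. f ` verts H \<subseteq> verts G \<and> inj_on f (verts H) \<and>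
          (\<forall>i\<in>verts H. \<forall>j\<in>verts H. i < j \<longrightarrow> f i < f j) \<and>
          (\<forall>i\<in>verts H. \<forall>j\<in>verts H. {i, j} \<in> edges H \<longrightarrow> {f i, f j} \<in> edges G))"

abbreviation avoids :: "'a::linorder ograph \<Rightarrow> 'b::linorder ograph \<Rightarrow> bool" where
  "avoids G H \<equiv> \<not> contains G H"

definition bipartite_ordered_graph :: "nat \<Rightarrow> nat ograph \<Rightarrow> bool" where
  "bipartite_ordered_graph M G \<longleftrightarrow>
     ordered_graph G \<and> verts G = {1..2 * M} \<and>
     (\<forall>e\<in>edges G. \<exists>u\<in>{1..M}. \<exists>v\<in>{M + 1..2 * M}. e = {u, v})"

definition ex_bip :: "nat \<Rightarrow> 'b::linorder ograph \<Rightarrow> nat" where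
  "ex_bip M H = Max {card (edges G) | G. bipartite_ordered_graph M G \<and> avoids G H}"

definition path_graph :: "nat \<Rightarrow> (nat \<Rightarrow> nat) \<Rightarrow> nat ograph" where
  "path_graph n v = ({1..n}, {{v i, v (i + 1)} | i. 1 \<le> i \<and> i < n})"

text \<open>The sequence \<open>v\<close> with \<open>v (2 * j - 1) = a j\<close> and \<open>v (2 * j) = b j\<close> for \<open>j \<ge> 1\<close>.\<close>

definition interleave :: "(nat \<Rightarrow> nat) \<Rightarrow> (nat \<Rightarrow> nat) \<Rightarrow> nat \<Rightarrow> nat" where
  "interleave a b i = (if odd i then a ((i + 1) div 2) else b (i div 2))"

text \<open>The four paths below are meant for even \<open>n\<close>; all subtractions occur with \<open>j \<le> k\<close>
  only and hence do not truncate.\<close>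

definition P_less_less :: "nat \<Rightarrow> nat ograph" where
  "P_less_less n =
     (let k = n div 2 in path_graph n (interleave (\<lambda>j. j) (\<lambda>j. k + j)))"

definition P_greater_greater :: "nat \<Rightarrow> nat ograph" where
  "P_greater_greater n =
     (let k = n div 2 in path_graph n (interleave (\<lambda>j. k + 1 - j) (\<lambda>j. 2 * k + 1 - j)))"

definition P_less_greater :: "nat \<Rightarrow> nat ograph" where
  "P_less_greater n =
     (let k = n div 2 in path_graph n (interleave (\<lambda>j. j) (\<lambda>j. 2 * k + 1 - j)))"

definition P_greater_less :: "nat \<Rightarrow> nat ograph" where
  "P_greater_less n =
     (let k = n div 2 in path_graph n (interleave (\<lambda>j. k + 1 - j) (\<lambda>j. k + j)))"

lemma interleave_odd: "j \<ge> 1 \<Longrightarrow> interleave a b (2 * j - 1) = a j"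
  by (cases j) (auto simp: interleave_def)

lemma interleave_even: "interleave a b (2 * j) = b j"
  by (simp add: interleave_def)

lemma finite_bipartite_ordered_graphs: "finite {G. bipartite_ordered_graph M G}"
proof (rule finite_subset)
  show "{G. bipartite_ordered_graph M G} \<subseteq> {{1..2 * M}} \<times> Pow (Pow {1..2 * M})"
    by (force simp: bipartite_ordered_graph_def ordered_graph_def)
qed simp

text \<open>Whenever \<open>H\<close> has an edge, the maximum defining \<open>ex_bip M H\<close> is taken over a nonempty
  finite set.\<close>

lemma ex_bip_set:
  fixes H :: "'b::linorder ograph"
  assumes "ordered_graph H" "edges H \<noteq> {}"
  shows "finite {card (edges G) | G. bipartite_ordered_graph M G \<and> avoids G H}"
    and "{card (edges G) | G. bipartite_ordered_graph M G \<and> avoids G H} \<noteq> {}"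
proof -
  have "{card (edges G) | G. bipartite_ordered_graph M G \<and> avoids G H}
      \<subseteq> (\<lambda>G. card (edges G)) ` {G. bipartite_ordered_graph M G}" by blast
  then show "finite {card (edges G) | G. bipartite_ordered_graph M G \<and> avoids G H}"
    using finite_bipartite_ordered_graphs finite_surj by blast
  let ?G = "({1..2 * M}, {}) :: nat ograph"
  obtain e where e: "e \<in> edges H" "e \<subseteq> verts H" "card e = 2"
    using assms by (auto simp: ordered_graph_def)
  then obtain i j where "e = {i, j}" by (auto simp: card_2_iff)
  with e have "avoids ?G H" by (auto simp: contains_def)
  moreover have "bipartite_ordered_graph M ?G"
    by (simp add: bipartite_ordered_graph_def ordered_graph_def)
  ultimately show "{card (edges G) | G. bipartite_ordered_graph M G \<and> avoids G H} \<noteq> {}"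
    by blast
qed

end

theory Submission
  imports Defs
begin

text \<open>Read a bipartite ordered graph as the set of ones of an \<open>M \<times> M\<close> matrix. Reversing the rows
  and/or the columns turns each of the four paths into the same staircase pattern
  \<open>(r\<^sub>1,c\<^sub>1), (r\<^sub>2,c\<^sub>1), (r\<^sub>2,c\<^sub>2), \<dots>, (r\<^sub>k,c\<^sub>k)\<close>. Removing the topmost one of every column and
  then the leftmost remaining one of every row deletes at most \<open>M + (M - 1)\<close> ones, leaves the first
  row and the first column empty, and shortens the longest staircase by one corner; the upper bound
  follows by induction on \<open>k\<close>. The bound is attained by the first \<open>k - 1\<close> rows and columns.\<close>

section \<open>Staircases in a matrix and the upper bound\<close>

definition staircase :: "nat \<Rightarrow> (nat \<times> nat) set \<Rightarrow> bool" where
  "staircase k E \<longleftrightarrow> (\<exists>r c. strict_mono_on {1..k} r \<and> strict_mono_on {1..k} c \<and>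
     (\<forall>j\<in>{1..k}. (r j, c j) \<in> E) \<and> (\<forall>j\<in>{1..<k}. (r (Suc j), c j) \<in> E))"

text \<open>A new first corner is prepended: from \<open>(r 1, c 1)\<close> in \<open>F\<close> a
  move to the left reaches \<open>(r 1, y)\<close> in \<open>E'\<close>, and from there a move up
  reaches \<open>(x, y)\<close> in \<open>E\<close>. So \<open>x\<close> and \<open>y\<close>
  precede all old rows and columns.\<close>

lemma staircase_extend:
  assumes st: "staircase k F" and k: "k \<ge> 1"
    and left: "\<And>x y. (x, y) \<in> F \<Longrightarrow> \<exists>y'<y. (x, y') \<in> E'"
    and up: "\<And>x y. (x, y) \<in> E' \<Longrightarrow> \<exists>x'<x. (x', y) \<in> E"
    and sub: "F \<subseteq> E" "E' \<subseteq> E"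
  shows "staircase (Suc k) E"
proof -
  obtain r c where r: "strict_mono_on {1..k} r" and c: "strict_mono_on {1..k} c"
    and d: "\<And>j. j \<in> {1..k} \<Longrightarrow> (r j, c j) \<in> F"
    and s: "\<And>j. j \<in> {1..<k} \<Longrightarrow> (r (Suc j), c j) \<in> F"
    using st by (auto simp: staircase_def)
  obtain y where y: "y < c 1" "(r 1, y) \<in> E'" using left[OF d[of 1]] k by auto
  obtain x where x: "x < r 1" "(x, y) \<in> E" using up[OF y(2)] by auto
  define r' where "r' j = (if j = 1 then x else r (j - 1))" for j
  define c' where "c' j = (if j = 1 then y else c (j - 1))" for j
  have mono: "strict_mono_on {1..Suc k} (\<lambda>j. if j = 1 then z else g (j - 1))"
    if g: "strict_mono_on {1..k} g" and z: "z < g 1" for g :: "nat \<Rightarrow> nat" and z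
  proof (rule strict_mono_onI)
    fix i j assume ij: "i \<in> {1..Suc k}" "j \<in> {1..Suc k}" "i < j"
    have "g 1 \<le> g (j - 1)"
      using ij by (intro monotone_onD[OF strict_mono_on_imp_mono_on[OF g]]) auto
    moreover have "g (i - 1) < g (j - 1)" if "i \<noteq> 1"
      using ij that by (intro strict_mono_onD[OF g]) auto
    ultimately show "(if i = 1 then z else g (i - 1)) < (if j = 1 then z else g (j - 1))"
      using ij z by auto
  qed
  have "strict_mono_on {1..Suc k} r'" "strict_mono_on {1..Suc k} c'"
    using mono[OF r x(1)] mono[OF c y(1)] by (simp_all add: r'_def[abs_def] c'_def[abs_def])
  moreover have "(r' j, c' j) \<in> E" if "j \<in> {1..Suc k}" for j
  proof (cases "j = 1")
    case False
    then have "j - 1 \<in> {1..k}" using that by auto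
    from d[OF this] show ?thesis using False sub by (auto simp: r'_def c'_def)
  qed (use x in \<open>simp add: r'_def c'_def\<close>)
  moreover have "(r' (Suc j), c' j) \<in> E" if "j \<in> {1..<Suc k}" for j
  proof (cases "j = 1")
    case False
    then have "j - 1 \<in> {1..<k}" "Suc (j - 1) = j" using that by auto
    with s[OF this(1)] show ?thesis using False sub that by (auto simp: r'_def c'_def)
  qed (use y sub in \<open>auto simp: r'_def c'_def\<close>)
  ultimately show ?thesis unfolding staircase_def by blast
qed

text \<open>Each peeling costs at most \<open>m + (m - 1)\<close> cells and passes to a box of side
  \<open>m - 1\<close>; \<open>l\<close> of them sum to \<open>l * (2 * m - l)\<close>, and what
  remains has no staircase with one corner, hence is empty. The offsets \<open>a\<close> and
  \<open>b\<close> are general because the box loses its first row and column in each step.\<close>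

lemma card_le_if_no_staircase:
  assumes "E \<subseteq> {a<..a + m} \<times> {b<..b + m}" "\<not> staircase (Suc l) E" "l \<le> m"
  shows "card E \<le> l * (2 * m - l)"
  using assms
proof (induction l arbitrary: E a b m)
  case 0
  have "E = {}"
  proof (rule ccontr)
    assume "E \<noteq> {}"
    then obtain x y where xy: "(x, y) \<in> E" by auto
    have "staircase (Suc 0) E" unfolding staircase_def
      by (rule exI[of _ "\<lambda>_. x"], rule exI[of _ "\<lambda>_. y"]) (auto simp: xy strict_mono_on_def)
    with 0 show False by simp
  qed
  then show ?case by simp
next
  case (Suc l)
  obtain m' where m: "m = Suc m'" using Suc.prems(3) by (cases m) auto
  have fin: "finite E" using Suc.prems(1) finite_subset by blast
  \<comment> \<open>\<open>T\<close> has the topmost cell of each column. \<open>L\<close> has the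
    leftmost cell of each row of \<open>E'\<close>, not of \<open>E\<close>: a move left from
    \<open>F\<close> then stays in \<open>E'\<close>, where a move up is still possible.\<close>
  define T where "T = {(x, y) \<in> E. \<forall>x'. (x', y) \<in> E \<longrightarrow> x \<le> x'}"
  define E' where "E' = E - T"
  define L where "L = {(x, y) \<in> E'. \<forall>y'. (x, y') \<in> E' \<longrightarrow> y \<le> y'}"
  define F where "F = E' - L"
  have up: "\<exists>x'<x. (x', y) \<in> E" if "(x, y) \<in> E'" for x y
    using that by (auto simp: E'_def T_def not_le)
  have left: "\<exists>y'<y. (x, y') \<in> E'" if "(x, y) \<in> F" for x y
    using that by (auto simp: F_def L_def not_le)
  \<comment> \<open>A cell of \<open>E'\<close> has a cell of \<open>E\<close> above it, so row
    \<open>a + 1\<close> is empty. This leaves \<open>m'\<close> rows, which is why \<open>L\<close>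
    has at most \<open>m'\<close> cells.\<close>
  have E': "E' \<subseteq> {Suc a<..Suc a + m'} \<times> {b<..b + m}"
  proof clarify
    fix x y assume xy: "(x, y) \<in> E'"
    then have "(x, y) \<in> E" by (simp add: E'_def)
    with up[OF xy] Suc.prems(1) m
    show "x \<in> {Suc a<..Suc a + m'} \<and> y \<in> {b<..b + m}" by fastforce
  qed
  have F: "F \<subseteq> {Suc a<..Suc a + m'} \<times> {Suc b<..Suc b + m'}"
  proof clarify
    fix x y assume xy: "(x, y) \<in> F"
    then have "(x, y) \<in> E'" by (simp add: F_def)
    with left[OF xy] E' m
    show "x \<in> {Suc a<..Suc a + m'} \<and> y \<in> {Suc b<..Suc b + m'}" by fastforce
  qed
  have "inj_on snd T" by (auto simp: inj_on_def T_def intro: order.antisym)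
  moreover have "snd ` T \<subseteq> {b<..b + m}" using Suc.prems(1) by (auto simp: T_def)
  ultimately have T: "card T \<le> m" using card_inj_on_le[of snd T "{b<..b + m}"] by simp
  have "inj_on fst L" by (auto simp: inj_on_def L_def intro: order.antisym)
  moreover have "fst ` L \<subseteq> {Suc a<..Suc a + m'}" using E' by (auto simp: L_def)
  ultimately have L: "card L \<le> m'" using card_inj_on_le[of fst L "{Suc a<..Suc a + m'}"] by simp
  have "\<not> staircase (Suc l) F"
    using staircase_extend[of "Suc l" F E' E] left up Suc.prems(2)
    by (auto simp: F_def E'_def)
  then have IH: "card F \<le> l * (2 * m' - l)"
    using Suc.IH[OF F] Suc.prems(3) m by simp
  have "E = T \<union> (L \<union> F)" by (auto simp: F_def E'_def T_def L_def)
  then have "card E \<le> card T + (card L + card F)"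
    by (metis card_Un_le order_trans add_left_mono)
  also have "\<dots> \<le> m + (m' + l * (2 * m' - l))" using T L IH by simp
  also have "\<dots> = Suc l * (2 * m - Suc l)"
  proof -
    \<comment> \<open>Writing \<open>m'\<close> as \<open>l + d\<close> removes the truncated
      subtractions.\<close>
    obtain d where "m' = l + d" using Suc.prems(3) m by (auto simp: le_iff_add)
    then show ?thesis using m by (simp add: algebra_simps)
  qed
  finally show ?case .
qed

section \<open>The extremal matrix\<close>

text \<open>Strictly increasing sequences of positive integers satisfy \<open>j \<le> r j\<close>
  and \<open>j \<le> c j\<close>, so the last corner has both coordinates above \<open>l\<close> and
  misses the hook.\<close>

lemma no_staircase_hook: "\<not> staircase (Suc l) {(x, y) \<in> {1..M} \<times> {1..M}. x \<le> l \<or> y \<le> l}"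
proof
  assume "staircase (Suc l) {(x, y) \<in> {1..M} \<times> {1..M}. x \<le> l \<or> y \<le> l}" (is "staircase _ ?E")
  then obtain r c where r: "strict_mono_on {1..Suc l} r" and c: "strict_mono_on {1..Suc l} c"
    and d: "\<And>j. j \<in> {1..Suc l} \<Longrightarrow> (r j, c j) \<in> ?E"
    by (auto simp: staircase_def)
  have ge: "j \<le> g j" if g: "strict_mono_on {1..Suc l} g" and "1 \<le> g 1" "1 \<le> j" "j \<le> Suc l"
    for g :: "nat \<Rightarrow> nat" and j
    using that(3,4)
  proof (induction j rule: dec_induct)
    case (step i)
    then show ?case using strict_mono_onD[OF g, of i "Suc i"] by simp
  qed (use that in simp)
  have "1 \<le> r 1" "1 \<le> c 1" using d[of 1] by auto
  then have "Suc l \<le> r (Suc l)" "Suc l \<le> c (Suc l)" using ge[OF r] ge[OF c] by auto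
  then show False using d[of "Suc l"] by auto
qed

text \<open>The hook is the complement of a square of side \<open>M - l\<close>.\<close>

lemma card_hook:
  assumes "l \<le> M"
  shows "card {(x, y) \<in> {1..M} \<times> {1..M}. x \<le> l \<or> y \<le> l} = l * (2 * M - l)"
proof -
  have "{(x, y) \<in> {1..M} \<times> {1..M}. x \<le> l \<or> y \<le> l} = {1..M} \<times> {1..M} - {l<..M} \<times> {l<..M}"
    by auto
  then have "card {(x, y) \<in> {1..M} \<times> {1..M}. x \<le> l \<or> y \<le> l} = M * M - (M - l) * (M - l)"
    by (simp add: card_Diff_subset card_cartesian_product Sigma_mono subset_iff)
  also have "\<dots> = l * (2 * M - l)"
  proof -
    obtain d where "M = l + d" using assms by (auto simp: le_iff_add)
    then show ?thesis by (simp add: algebra_simps)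
  qed
  finally show ?thesis .
qed

section \<open>Bipartite ordered graphs as reflected matrices\<close>

text \<open>The Boolean lets one argument serve all four paths. The map is meant for
  \<open>{1..k}\<close>, where it is an involution and nothing truncates.\<close>

definition flip :: "bool \<Rightarrow> nat \<Rightarrow> nat \<Rightarrow> nat" where
  "flip p k j = (if p then k + 1 - j else j)"

lemma flip_in: "j \<in> {1..k} \<Longrightarrow> flip p k j \<in> {1..k}"
  by (auto simp: flip_def)

lemma flip_flip: "j \<in> {1..k} \<Longrightarrow> flip p k (flip p k j) = j"
  by (auto simp: flip_def)

lemma flip_less_iff:
  "i \<in> {1..k} \<Longrightarrow> j \<in> {1..k} \<Longrightarrow> flip p k i < flip p k j \<longleftrightarrow> (if p then j < i else i < j)"
  by (auto simp: flip_def)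

text \<open>Rows become the first half of the vertices and columns the second half, reversed
  according to \<open>p\<close> and \<open>q\<close> so as to match the reversals in
  \<open>zigzag p q\<close>.\<close>

definition matrix_graph :: "bool \<Rightarrow> bool \<Rightarrow> nat \<Rightarrow> (nat \<times> nat) set \<Rightarrow> nat ograph" where
  "matrix_graph p q M E = ({1..2 * M}, (\<lambda>(x, y). {flip p M x, M + flip q M y}) ` E)"

definition zigzag :: "bool \<Rightarrow> bool \<Rightarrow> nat \<Rightarrow> nat ograph" where
  "zigzag p q k = path_graph (2 * k) (interleave (flip p k) (\<lambda>j. k + flip q k j))"

text \<open>Row vertices are at most \<open>M\<close> and column vertices exceed it, so
  \<open>u < v\<close> tells which end is the row; applying the reversals again recovers the
  cell.\<close>

lemma matrix_graph_edgeD: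
  assumes "E \<subseteq> {1..M} \<times> {1..M}" "{u, v} \<in> edges (matrix_graph p q M E)" "u < v"
  shows "u \<in> {1..M}" "v - M \<in> {1..M}" "M < v" "(flip p M u, flip q M (v - M)) \<in> E"
proof -
  obtain x y where xy: "(x, y) \<in> E" and uv: "{u, v} = {flip p M x, M + flip q M y}"
    using assms(2) by (auto simp: matrix_graph_def)
  have mem: "x \<in> {1..M}" "y \<in> {1..M}" using xy assms(1) by auto
  have "u = flip p M x \<and> v = M + flip q M y"
    using uv assms(3) flip_in[OF mem(1), of p] by (auto simp: doubleton_eq_iff)
  then show "u \<in> {1..M}" "v - M \<in> {1..M}" "M < v" "(flip p M u, flip q M (v - M)) \<in> E"
    using mem flip_in[OF mem(1), of p] flip_in[OF mem(2), of q] xy by (simp_all add: flip_flip)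
qed

lemma card_edges_matrix_graph:
  assumes "E \<subseteq> {1..M} \<times> {1..M}"
  shows "card (edges (matrix_graph p q M E)) = card E"
proof -
  have "inj_on (\<lambda>(x, y). {flip p M x, M + flip q M y}) E"
  proof (rule inj_onI, clarify)
    fix x y x' y' assume E: "(x, y) \<in> E" "(x', y') \<in> E"
      and eq: "{flip p M x, M + flip q M y} = {flip p M x', M + flip q M y'}"
    have mem: "x \<in> {1..M}" "y \<in> {1..M}" "x' \<in> {1..M}" "y' \<in> {1..M}" using E assms by auto
    have "flip p M x = flip p M x' \<and> flip q M y = flip q M y'"
      using eq mem[THEN flip_in, of p] mem[THEN flip_in, of q] by (auto simp: doubleton_eq_iff)
    then show "x = x' \<and> y = y'" using mem by (metis flip_flip)
  qed
  then show ?thesis by (simp add: matrix_graph_def card_image)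
qed

text \<open>Reversals are bijections of each half, so \<open>p\<close> and \<open>q\<close> are
  arbitrary and the matrix reading of a graph can be adapted to the path that is to be
  avoided.\<close>

lemma bipartite_ordered_graph_iff:
  "bipartite_ordered_graph M G \<longleftrightarrow> (\<exists>E \<subseteq> {1..M} \<times> {1..M}. G = matrix_graph p q M E)"
proof
  assume G: "bipartite_ordered_graph M G"
  define E where "E = {(x, y) \<in> {1..M} \<times> {1..M}. {flip p M x, M + flip q M y} \<in> edges G}"
  have "edges G \<subseteq> edges (matrix_graph p q M E)"
  proof
    fix e assume e: "e \<in> edges G"
    then obtain u v where "u \<in> {1..M}" "v \<in> {M + 1..2 * M}" "e = {u, v}"
      using G unfolding bipartite_ordered_graph_def by blast
    then have "u \<in> {1..M}" "v - M \<in> {1..M}" "e = {u, M + (v - M)}" by auto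
    then obtain u w where uw: "u \<in> {1..M}" "w \<in> {1..M}" "e = {u, M + w}" by blast
    have "(flip p M u, flip q M w) \<in> E"
      unfolding E_def using flip_in[OF uw(1), of p] flip_in[OF uw(2), of q] e uw
      by (simp add: flip_flip)
    moreover have "e = {flip p M (flip p M u), M + flip q M (flip q M w)}"
      using uw by (simp add: flip_flip)
    ultimately show "e \<in> edges (matrix_graph p q M E)" by (force simp: matrix_graph_def)
  qed
  moreover have "edges (matrix_graph p q M E) \<subseteq> edges G"
    by (auto simp: matrix_graph_def E_def)
  ultimately have "G = matrix_graph p q M E"
    using G by (intro prod_eqI) (auto simp: bipartite_ordered_graph_def matrix_graph_def)
  then show "\<exists>E \<subseteq> {1..M} \<times> {1..M}. G = matrix_graph p q M E"
    by (intro exI[of _ E] conjI) (auto simp: E_def)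
next
  assume "\<exists>E \<subseteq> {1..M} \<times> {1..M}. G = matrix_graph p q M E"
  then obtain E where E: "E \<subseteq> {1..M} \<times> {1..M}" and G: "G = matrix_graph p q M E" by blast
  have bip: "\<exists>u\<in>{1..M}. \<exists>v\<in>{M + 1..2 * M}. e = {u, v}" if e: "e \<in> edges G" for e
  proof -
    obtain x y where xy: "(x, y) \<in> E" "e = {flip p M x, M + flip q M y}"
      using e by (auto simp: G matrix_graph_def)
    then have "flip p M x \<in> {1..M}" "flip q M y \<in> {1..M}" using E by (blast intro: flip_in)+
    then show ?thesis using xy by (intro bexI[of _ "flip p M x"] bexI[of _ "M + flip q M y"]) auto
  qed
  have "e \<subseteq> {1..2 * M} \<and> card e = 2" if e: "e \<in> edges G" for e
  proof -
    obtain u v where "u \<in> {1..M}" "v \<in> {M + 1..2 * M}" "e = {u, v}" using bip[OF e] by blast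
    then show ?thesis by auto
  qed
  moreover have "verts G = {1..2 * M}" by (simp add: G matrix_graph_def)
  ultimately show "bipartite_ordered_graph M G"
    unfolding bipartite_ordered_graph_def ordered_graph_def using bip by simp
qed

section \<open>Containment of a path as a staircase\<close>

text \<open>Path edges from position \<open>2 * j - 1\<close> to \<open>2 * j\<close> are the
  corners of a staircase, those from \<open>2 * j\<close> to \<open>2 * j + 1\<close> its connecting
  cells.\<close>

lemma edges_zigzag:
  "edges (zigzag p q k) = {{flip p k j, k + flip q k j} | j. j \<in> {1..k}} \<union>
     {{flip p k (Suc j), k + flip q k j} | j. j \<in> {1..<k}}" (is "_ = ?A \<union> ?B")
proof
  show "edges (zigzag p q k) \<subseteq> ?A \<union> ?B"
  proof
    fix e assume "e \<in> edges (zigzag p q k)"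
    then obtain i where i: "1 \<le> i" "i < 2 * k"
      and e: "e = {interleave (flip p k) (\<lambda>j. k + flip q k j) i,
                   interleave (flip p k) (\<lambda>j. k + flip q k j) (Suc i)}"
      by (auto simp: zigzag_def path_graph_def)
    show "e \<in> ?A \<union> ?B"
    proof (cases "even i")
      case True
      then obtain j where j: "i = 2 * j" by auto
      then have "e = {flip p k (Suc j), k + flip q k j}" "j \<in> {1..<k}"
        using e i by (auto simp: interleave_def)
      then show ?thesis by blast
    next
      case False
      then obtain j where j: "i = 2 * j + 1" by (auto elim: oddE)
      then have "e = {flip p k (Suc j), k + flip q k (Suc j)}" "Suc j \<in> {1..k}"
        using e i by (auto simp: interleave_def)
      then show ?thesis by blast
    qed
  qed
  show "?A \<union> ?B \<subseteq> edges (zigzag p q k)"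
  proof
    fix e assume "e \<in> ?A \<union> ?B"
    then consider j where "j \<in> {1..k}" "e = {flip p k j, k + flip q k j}"
      | j where "j \<in> {1..<k}" "e = {flip p k (Suc j), k + flip q k j}" by blast
    then show "e \<in> edges (zigzag p q k)"
    proof cases
      case 1
      then have "e = {interleave (flip p k) (\<lambda>j. k + flip q k j) (2 * j - 1),
                      interleave (flip p k) (\<lambda>j. k + flip q k j) (2 * j - 1 + 1)}"
        using interleave_odd[of j] by (simp add: interleave_even)
      then show ?thesis using 1(1) unfolding zigzag_def path_graph_def by fastforce
    next
      case 2
      then have "e = {interleave (flip p k) (\<lambda>j. k + flip q k j) (2 * j),
                      interleave (flip p k) (\<lambda>j. k + flip q k j) (2 * j + 1)}"
        by (auto simp: interleave_def)
      then show ?thesis using 2(1) unfolding zigzag_def path_graph_def by fastforce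
    qed
  qed
qed

lemma verts_zigzag: "verts (zigzag p q k) = {1..2 * k}"
  by (simp add: zigzag_def path_graph_def)

text \<open>A reversal in the path meets the same reversal in the matrix, so conjugating by
  \<open>flip\<close> turns an embedding into increasing choices of rows and columns, and back. The
  further point is that an embedding keeps the two halves apart.\<close>

lemma contains_zigzag_iff:
  assumes E: "E \<subseteq> {1..M} \<times> {1..M}"
  shows "contains (matrix_graph p q M E) (zigzag p q k) \<longleftrightarrow> staircase k E"
proof
  assume "contains (matrix_graph p q M E) (zigzag p q k)"
  then obtain f where "\<forall>i\<in>{1..2 * k}. \<forall>j\<in>{1..2 * k}. i < j \<longrightarrow> f i < f j"
    "\<forall>i\<in>{1..2 * k}. \<forall>j\<in>{1..2 * k}. {i, j} \<in> edges (zigzag p q k) \<longrightarrow>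
      {f i, f j} \<in> edges (matrix_graph p q M E)"
    unfolding contains_def verts_zigzag by (elim exE conjE)
  then have mono: "\<And>i j. i \<in> {1..2 * k} \<Longrightarrow> j \<in> {1..2 * k} \<Longrightarrow> i < j \<Longrightarrow> f i < f j"
    and edge: "\<And>i j. i \<in> {1..2 * k} \<Longrightarrow> j \<in> {1..2 * k} \<Longrightarrow> {i, j} \<in> edges (zigzag p q k) \<Longrightarrow>
      {f i, f j} \<in> edges (matrix_graph p q M E)"
    by simp_all
  define r where "r j = flip p M (f (flip p k j))" for j
  define c where "c j = flip q M (f (k + flip q k j) - M)" for j
  \<comment> \<open>The smaller end of an edge of the matrix graph is a row, and \<open>f\<close>
    preserves the order. As each vertex of the path lies on a corner edge, \<open>f\<close> maps the
    first half into \<open>{1..M}\<close> and the second half beyond \<open>M\<close>.\<close>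
  have cell: "f (flip p k i) \<in> {1..M}" "f (k + flip q k j) - M \<in> {1..M}"
      "M < f (k + flip q k j)" "(r i, c j) \<in> E"
    if "i \<in> {1..k}" "j \<in> {1..k}" "{flip p k i, k + flip q k j} \<in> edges (zigzag p q k)" for i j
  proof -
    have mem: "flip p k i \<in> {1..2 * k}" "k + flip q k j \<in> {1..2 * k}"
      and less: "flip p k i < k + flip q k j"
      using flip_in[OF that(1), of p] flip_in[OF that(2), of q] by auto
    show "f (flip p k i) \<in> {1..M}" "f (k + flip q k j) - M \<in> {1..M}"
      "M < f (k + flip q k j)" "(r i, c j) \<in> E"
      using matrix_graph_edgeD[OF E edge[OF mem that(3)] mono[OF mem less]]
      by (simp_all add: r_def c_def)
  qed
  have diag: "{flip p k j, k + flip q k j} \<in> edges (zigzag p q k)" if "j \<in> {1..k}" for j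
    using that unfolding edges_zigzag by blast
  have sub: "{flip p k (Suc j), k + flip q k j} \<in> edges (zigzag p q k)" if "j \<in> {1..<k}" for j
    using that unfolding edges_zigzag by blast
  have "strict_mono_on {1..k} r"
  proof (rule strict_mono_onI)
    fix i j assume ij: "i \<in> {1..k}" "j \<in> {1..k}" "i < j"
    have "if p then f (flip p k j) < f (flip p k i) else f (flip p k i) < f (flip p k j)"
      using ij flip_less_iff[OF ij(1,2), of p] flip_less_iff[OF ij(2,1), of p]
        flip_in[OF ij(1), of p] flip_in[OF ij(2), of p]
      by (auto intro!: mono)
    then show "r i < r j"
      unfolding r_def using cell(1)[OF ij(1) ij(1) diag[OF ij(1)]] cell(1)[OF ij(2) ij(2) diag[OF ij(2)]]
      by (simp add: flip_less_iff)
  qed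
  moreover have "strict_mono_on {1..k} c"
  proof (rule strict_mono_onI)
    fix i j assume ij: "i \<in> {1..k}" "j \<in> {1..k}" "i < j"
    have "if q then f (k + flip q k j) < f (k + flip q k i) else f (k + flip q k i) < f (k + flip q k j)"
      using ij flip_less_iff[OF ij(1,2), of q] flip_less_iff[OF ij(2,1), of q]
        flip_in[OF ij(1), of q] flip_in[OF ij(2), of q]
      by (auto intro!: mono)
    \<comment> \<open>All these values exceed \<open>M\<close>, so subtracting \<open>M\<close>
      keeps the order strict.\<close>
    then have "if q then f (k + flip q k j) - M < f (k + flip q k i) - M
        else f (k + flip q k i) - M < f (k + flip q k j) - M"
      using cell(3)[OF ij(1) ij(1) diag[OF ij(1)]] cell(3)[OF ij(2) ij(2) diag[OF ij(2)]]
      by (auto split: if_splits)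
    then show "c i < c j"
      unfolding c_def using cell(2)[OF ij(1) ij(1) diag[OF ij(1)]] cell(2)[OF ij(2) ij(2) diag[OF ij(2)]]
      by (simp add: flip_less_iff)
  qed
  moreover have "(r j, c j) \<in> E" if "j \<in> {1..k}" for j
    using cell(4)[OF that that diag[OF that]] .
  moreover have "(r (Suc j), c j) \<in> E" if "j \<in> {1..<k}" for j
    using that by (intro cell(4) sub) auto
  ultimately show "staircase k E" unfolding staircase_def by blast
next
  assume "staircase k E"
  then obtain r c where r: "strict_mono_on {1..k} r" and c: "strict_mono_on {1..k} c"
    and d: "\<And>j. j \<in> {1..k} \<Longrightarrow> (r j, c j) \<in> E"
    and s: "\<And>j. j \<in> {1..<k} \<Longrightarrow> (r (Suc j), c j) \<in> E"
    by (auto simp: staircase_def)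
  have rc: "r j \<in> {1..M}" "c j \<in> {1..M}" if "j \<in> {1..k}" for j using d[OF that] E by auto
  \<comment> \<open>The conjugation is undone: positions up to \<open>k\<close> go to the chosen
    rows, later ones to the chosen columns.\<close>
  define f where "f i = (if i \<le> k then flip p M (r (flip p k i))
    else M + flip q M (c (flip q k (i - k))))" for i
  \<comment> \<open>Reversing both argument and value preserves strict increase.\<close>
  have mono_flip: "flip b M (g (flip b k i)) < flip b M (g (flip b k j))"
    if g: "strict_mono_on {1..k} g" and im: "\<And>j. j \<in> {1..k} \<Longrightarrow> g j \<in> {1..M}"
      and ij: "i \<in> {1..k}" "j \<in> {1..k}" "i < j" for b i j and g :: "nat \<Rightarrow> nat"
  proof -
    note fl = flip_in[OF ij(1), of b] flip_in[OF ij(2), of b]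
    have "if b then g (flip b k j) < g (flip b k i) else g (flip b k i) < g (flip b k j)"
      using strict_mono_onD[OF g fl] strict_mono_onD[OF g fl(2,1)]
        flip_less_iff[OF ij(1,2), of b] flip_less_iff[OF ij(2,1), of b] ij(3) by auto
    then show ?thesis using flip_less_iff[OF im[OF fl(1)] im[OF fl(2)], of b] by simp
  qed
  have low: "f i \<in> {1..M}" if "i \<in> {1..k}" for i
    using that flip_in[OF rc(1)[OF flip_in[OF that, of p]], of p] by (simp add: f_def)
  have high: "f i \<in> {M + 1..2 * M}" if "i \<in> {k + 1..2 * k}" for i
  proof -
    have "i - k \<in> {1..k}" using that by auto
    from flip_in[OF rc(2)[OF flip_in[OF this, of q]], of q] show ?thesis
      using that by (simp add: f_def)
  qed
  have mono: "f i < f j" if ij: "i \<in> {1..2 * k}" "j \<in> {1..2 * k}" "i < j" for i j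
  proof -
    consider "j \<le> k" | "i \<le> k" "k < j" | "k < i" using ij by linarith
    then show ?thesis
    proof cases
      case 1
      then show ?thesis using mono_flip[OF r rc(1), of i j p] ij by (simp add: f_def)
    next
      case 2
      then show ?thesis using low[of i] high[of j] ij by fastforce
    next
      case 3
      then have "i - k \<in> {1..k}" "j - k \<in> {1..k}" "i - k < j - k" using ij by auto
      from mono_flip[OF c rc(2) this, of q] show ?thesis using 3 ij by (simp add: f_def)
    qed
  qed
  have f_row: "f (flip p k j) = flip p M (r j)" if "j \<in> {1..k}" for j
    using flip_in[OF that, of p] flip_flip[OF that, of p] by (simp add: f_def)
  have f_col: "f (k + flip q k j) = M + flip q M (c j)" if "j \<in> {1..k}" for j
    using flip_in[OF that, of q] flip_flip[OF that, of q] by (simp add: f_def)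
  \<comment> \<open>Stated for the image of a whole edge, so that it does not matter which of the
    two vertices in \<open>contains\<close> is the row end.\<close>
  have edge: "f ` e \<in> edges (matrix_graph p q M E)" if "e \<in> edges (zigzag p q k)" for e
  proof -
    from that consider j where "j \<in> {1..k}" "e = {flip p k j, k + flip q k j}"
      | j where "j \<in> {1..<k}" "e = {flip p k (Suc j), k + flip q k j}"
      unfolding edges_zigzag by blast
    then show ?thesis
    proof cases
      case 1
      then have "f ` e = {flip p M (r j), M + flip q M (c j)}" by (simp add: f_row f_col)
      then show ?thesis using d[OF 1(1)] by (force simp: matrix_graph_def)
    next
      case 2
      then have "f ` e = {flip p M (r (Suc j)), M + flip q M (c j)}" by (simp add: f_row f_col)
      then show ?thesis using s[OF 2(1)] by (force simp: matrix_graph_def)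
    qed
  qed
  show "contains (matrix_graph p q M E) (zigzag p q k)"
    unfolding contains_def verts_zigzag
  proof (intro exI[of _ f] conjI ballI impI)
    show "f ` {1..2 * k} \<subseteq> verts (matrix_graph p q M E)"
    proof clarify
      fix i assume "i \<in> {1..2 * k}"
      then show "f i \<in> verts (matrix_graph p q M E)"
        using low[of i] high[of i] by (cases "i \<le> k") (auto simp: matrix_graph_def)
    qed
    show "inj_on f {1..2 * k}"
      using mono by (metis linorder_inj_onI' nat_neq_iff)
    show "{f i, f j} \<in> edges (matrix_graph p q M E)" if "{i, j} \<in> edges (zigzag p q k)" for i j
      using edge[OF that] by simp
  qed (use mono in auto)
qed

section \<open>The extremal number of the four paths\<close>

lemma ex_bip_zigzag:
  assumes "l < M"
  shows "ex_bip M (zigzag p q (Suc l)) = l * (2 * M - l)"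
  unfolding ex_bip_def
proof (rule Max_eqI)
  have "{card (edges G) | G. bipartite_ordered_graph M G \<and> avoids G (zigzag p q (Suc l))}
      \<subseteq> (\<lambda>G. card (edges G)) ` {G. bipartite_ordered_graph M G}" by blast
  then show "finite {card (edges G) | G. bipartite_ordered_graph M G \<and> avoids G (zigzag p q (Suc l))}"
    using finite_bipartite_ordered_graphs finite_surj by blast
next
  fix z assume "z \<in> {card (edges G) | G. bipartite_ordered_graph M G \<and> avoids G (zigzag p q (Suc l))}"
  then obtain G where G: "z = card (edges G)" "bipartite_ordered_graph M G"
    "avoids G (zigzag p q (Suc l))" by blast
  from G(2) obtain E where E: "E \<subseteq> {1..M} \<times> {1..M}" "G = matrix_graph p q M E"
    unfolding bipartite_ordered_graph_iff[of M G p q] by blast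
  have z: "z = card E" and st: "\<not> staircase (Suc l) E"
    using G E contains_zigzag_iff[OF E(1)] card_edges_matrix_graph[OF E(1)] by auto
  have "E \<subseteq> {0<..0 + M} \<times> {0<..0 + M}" using E(1) by force
  from card_le_if_no_staircase[OF this st] show "z \<le> l * (2 * M - l)"
    using z assms by simp
next
  \<comment> \<open>The extremal graph is the hook of the first \<open>l\<close> rows and columns,
    reflected by the \<open>p\<close> and \<open>q\<close> of the path.\<close>
  define E where "E = {(x, y) \<in> {1..M} \<times> {1..M}. x \<le> l \<or> y \<le> l}"
  have sub: "E \<subseteq> {1..M} \<times> {1..M}" by (auto simp: E_def)
  have "bipartite_ordered_graph M (matrix_graph p q M E)"
    using sub bipartite_ordered_graph_iff[of M _ p q] by blast
  moreover have "avoids (matrix_graph p q M E) (zigzag p q (Suc l))"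
    using contains_zigzag_iff[OF sub] no_staircase_hook by (simp add: E_def)
  moreover have "card (edges (matrix_graph p q M E)) = l * (2 * M - l)"
    using card_edges_matrix_graph[OF sub] card_hook[of l M] assms by (simp add: E_def)
  ultimately show "l * (2 * M - l)
      \<in> {card (edges G) | G. bipartite_ordered_graph M G \<and> avoids G (zigzag p q (Suc l))}"
    by (intro CollectI exI[of _ "matrix_graph p q M E"]) simp
qed

text \<open>A path on \<open>2 * k\<close> vertices evaluates both sequences on
  \<open>{1..k}\<close> only. The restriction matters: by truncation, \<open>2 * k + 1 - j\<close>
  and \<open>k + (k + 1 - j)\<close> may differ once \<open>j > k + 1\<close>.\<close>

lemma path_graph_interleave_cong:
  assumes "\<And>j. j \<in> {1..k} \<Longrightarrow> a j = a' j" "\<And>j. j \<in> {1..k} \<Longrightarrow> b j = b' j"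
  shows "path_graph (2 * k) (interleave a b) = path_graph (2 * k) (interleave a' b')"
proof -
  have "interleave a b i = interleave a' b' i" if "1 \<le> i" "i \<le> 2 * k" for i
    using that unfolding interleave_def by (auto elim!: oddE intro!: assms)
  then have "{interleave a b i, interleave a b (i + 1)} = {interleave a' b' i, interleave a' b' (i + 1)}"
    if "1 \<le> i \<and> i < 2 * k" for i using that by simp
  then show ?thesis unfolding path_graph_def by (metis (mono_tags, lifting))
qed

lemma paths_eq_zigzag:
  "P_less_less (2 * k) = zigzag False False k"
  "P_greater_greater (2 * k) = zigzag True True k"
  "P_less_greater (2 * k) = zigzag False True k"
  "P_greater_less (2 * k) = zigzag True False k"
  unfolding P_less_less_def P_greater_greater_def P_less_greater_def P_greater_less_def zigzag_def Let_def
  by (auto intro!: path_graph_interleave_cong simp: flip_def)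

theorem theorem4p1:
  fixes n N :: nat and P :: "nat ograph"
  assumes "n > 0" and "even n" and "N > 0" and "even N" and "N \<ge> n"
    and "P \<in> {P_less_less n, P_greater_greater n, P_less_greater n, P_greater_less n}"
  shows "int (ex_bip (N div 2) P) = (int n div 2 - 1) * (int N - int n div 2 + 1)"
proof -
  obtain k where k: "n = 2 * k" using assms(2) by blast
  then obtain l where l: "k = Suc l" using assms(1) by (cases k) auto
  obtain M where M: "N = 2 * M" using assms(4) by blast
  obtain p q where P: "P = zigzag p q (Suc l)" using assms(6) unfolding k paths_eq_zigzag l by blast
  have "l < M" using assms(5) k l M by simp
  \<comment> \<open>Here \<open>l\<close> is n/2 - 1, so \<open>2 * M - l\<close> is N - n/2 + 1;
    \<open>l < M\<close> lets the subtraction pass to the integers.\<close>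
  then have "int (ex_bip M P) = int l * (2 * int M - int l)"
    by (simp add: P ex_bip_zigzag)
  then show ?thesis by (simp add: k l M)
qed

end
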